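(* Let $\Gamma\cup\{\varphi\}$ be a set of formulas over $\Sigma=\{\land,\vee,\to,\neg,\circ\}$. The following assertions are equivalent: \begin{enumerate} \item $\Gamma\vdash_{\mathsf{mbC}}\varphi$; \item $\Gamma\models_{\mathsf{HmbCA}}\varphi$, i.e. $\varphi$ is a semantical consequence of $\Gamma$ with respect to the Nmatrices $\langle\mathsf A,\top\rangle$ of all hyper mbC algebras $\mathsf A$; \item $\Gamma\models^{\mathsf{HSW}}_{\mathsf{mbC}}\varphi$, i.e. $\varphi$ is a semantical consequence of $\Gamma$ with respect to the Nmatrices $\mathcal M^{\mathsf{mbC}}(\mathsf A)$ of the hyper swap structures for mbC over all hyper Boolean algebras $\mathsf A$. \end{enumerate}
   Context: Logic. Formulas over $\Sigma$ are generated from a denumerable set of propositional variables ($\neg,\circ$ unary; $\land,\vee,\to$ binary). The logic mbC is the Hilbert calculus with modus ponens as only rule and axiom schemas: $\alpha\to(\beta\to\alpha)$; $(\alpha\to(\beta\to\gamma))\to((\alpha\to\beta)\to(\alpha\to\gamma))$; $\alpha\to(\beta\to(\alpha\land\beta))$; $(\alpha\land\beta)\to\alpha$; $(\alpha\land\beta)\to\beta$; $\alpha\to(\alpha\lor\beta)$; $\beta\to(\alpha\lor\beta)$; $(\alpha\to\gamma)\to((\beta\to\gamma)\to((\alpha\lor\beta)\to\gamma))$; $\alpha\lor(\alpha\to\beta)$; $\alpha\lor\neg\alpha$; $\circ\alpha\to(\alpha\to(\neg\alpha\to\beta))$. $\Gamma\vdash_{\mathsf{mbC}}\varphi$ means derivability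 of $\varphi$ from $\Gamma$. Hyperstructures. A hyperoperation on a set assigns to each tuple of elements a non-empty subset. Hyperoperations are extended to non-empty subsets by unions: $A\# C=\bigcup_{a\in A,c\in C}a\# c$, $-A=\bigcup_{a\in A}-a$, etc.; an element $x$ is identified with $\{x\}$ where a set is expected. Let $\preceq$ be a preorder on a non-empty set $P$. Write $x\equiv y$ if $x\preceq y$ and $y\preceq x$. For subsets, $A\preceq C$ means $a\preceq c$ for all $a\in A,c\in C$, and $A\equiv C$ means $a\equiv c$ for all $a\in A$, $c\in C$. Put $\mathsf{Min}(A)=\{x\in A: x\preceq A\}$, $\mathsf{Max}(A)=\{x\in A: A\preceq x\}$, $\mathsf{Ub}(A)=\{z\in P: A\preceq z\}$, $\mathsf{Lb}(A)=\{z\in P: z\preceq A\}$. The supremoid is $x\curlyvee y=\mathsf{Min}(\mathsf{Ub}(\{x,y\}))$ and the infimoid is $x\curlywedge y=\mathsf{Max}(\mathsf{Lb}(\{x,y\}))$. $P$ is a (Morgado) hyperlattice if $x\curlyvee y$ and $x\curlywedge y$ are non-empty for all $x,y\in P$. Write $\top=\mathsf{Max}(P)$ and $\bot=\mathsf{Min}(P)$ (subsets of $P$). The hyperlattice is bounded if $\top\neq\emptyset\neq\bot$, and distributive if $x\curlywedge(y\curlyvee z)=(x\curlywedge y)\curlyvee(x\curlywedge z)$ and $x\curlyvee(y\curlywedge z)=(x\curlyvee y)\curlywedge(x\curlyvee z)$ for all $x,y,z$. A hyper Boolean algebra (HBA) is a hyperalgebra $\langle B,\curlywedge,\curlyvee,-,\top,\bot\rangle$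 such that $\langle B,\curlywedge,\curlyvee,\top,\bot\rangle$ is a bounded distributive hyperlattice and $-$ is a unary hyperoperation such that for all $x,y\in B$: (i) if $x\equiv y$ then $-x\equiv -y$; (ii) $x\in{-}{-}x$; (iii) $x\curlyvee -x\equiv\top$; (iv) $x\curlywedge -x\equiv\bot$. In an HBA, $x\multimap y:=-x\curlyvee y$. A hyper mbC algebra (HmbCA) is a hyperalgebra $\langle A,\curlywedge,\curlyvee,-,\bot,\top,\neg,\circ\rangle$ whose reduct without $\neg,\circ$ is an HBA and whose unary hyperoperations $\neg,\circ$ satisfy, for every $x\in A$: $x\curlyvee y\equiv\top$ for all $y\in\neg x$; and $(x\curlywedge y)\curlywedge z\equiv\bot$ for all $y\in\neg x$ and $z\in\circ x$. The hyper swap structure $\mathsf S^{\mathsf{mbC}}(\mathsf B)$ for mbC over an HBA $\mathsf B$ has domain $$S^{\mathsf{mbC}}_{\mathsf B}=\{z=(z_1,z_2,z_3)\in B^3: z_1\curlyvee z_2\equiv\top\text{ and }z_1\curlywedge z_2\curlywedge z_3\equiv\bot\}$$ and hyperoperations $z\# w=\{u\in S^{\mathsf{mbC}}_{\mathsf B}: u_1\in z_1\# w_1\}$ for $\#\in\{\curlywedge,\curlyvee,\multimap\}$, $\neg z=\{u\in S^{\mathsf{mbC}}_{\mathsf B}: u_1=z_2\}$, $\circ z=\{u\in S^{\mathsf{mbC}}_{\mathsf B}: u_1=z_3\}$. Semantics. HmbCAs and hyper swap structures are regarded as hyperalgebras over $\Sigma$ by interpreting $\land,\vee,\to,\neg,\circ$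 as $\curlywedge,\curlyvee,\multimap,\neg,\circ$. An Nmatrix is a pair $\mathcal M=\langle\mathsf A,D\rangle$ with $\mathsf A$ a hyperalgebra over $\Sigma$ and $\emptyset\neq D\subseteq A$. A valuation over $\mathcal M$ is a function $v$ from formulas to $A$ with $v(\#(\varphi_1,\dots,\varphi_n))\in\#(v(\varphi_1),\dots,v(\varphi_n))$ for each $n$-ary connective $\#$. $\Gamma\models_{\mathcal M}\varphi$ means: for every valuation $v$ over $\mathcal M$, if $v(\gamma)\in D$ for all $\gamma\in\Gamma$ then $v(\varphi)\in D$. $\Gamma\models_{\mathsf{HmbCA}}\varphi$ means $\Gamma\models_{\langle\mathsf A,\top\rangle}\varphi$ for every HmbCA $\mathsf A$. For an HBA $\mathsf A$, $\mathcal M^{\mathsf{mbC}}(\mathsf A)=\langle\mathsf S^{\mathsf{mbC}}(\mathsf A),D^{\mathsf{mbC}}(\mathsf A)\rangle$ with $D^{\mathsf{mbC}}(\mathsf A)=\{z\in S^{\mathsf{mbC}}_{\mathsf A}: z_1\in\top\}$, and $\Gamma\models^{\mathsf{HSW}}_{\mathsf{mbC}}\varphi$ means $\Gamma\models_{\mathcal M^{\mathsf{mbC}}(\mathsf A)}\varphi$ for every HBA $\mathsf A$. *)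

theory Defs
  imports Main
begin

section \<open>Formulas and the calculus\<close>

datatype fm =
    Var nat
  | Neg fm
  | Circ fm
  | Conj fm fm
  | Disj fm fm
  | Imp fm fm

inductive mbC_axiom :: "fm \<Rightarrow> bool" where
  Ax1: "mbC_axiom (Imp a (Imp b a))"
| Ax2: "mbC_axiom (Imp (Imp a (Imp b c)) (Imp (Imp a b) (Imp a c)))"
| Ax3: "mbC_axiom (Imp a (Imp b (Conj a b)))"
| Ax4: "mbC_axiom (Imp (Conj a b) a)"
| Ax5: "mbC_axiom (Imp (Conj a b) b)"
| Ax6: "mbC_axiom (Imp a (Disj a b))"
| Ax7: "mbC_axiom (Imp b (Disj a b))"
| Ax8: "mbC_axiom (Imp (Imp a c) (Imp (Imp b c) (Imp (Disj a b) c)))"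
| Ax9: "mbC_axiom (Disj a (Imp a b))"
| Ax10: "mbC_axiom (Disj a (Neg a))"
| bc1: "mbC_axiom (Imp (Circ a) (Imp a (Imp (Neg a) b)))"

inductive mbC_derivable :: "fm set \<Rightarrow> fm \<Rightarrow> bool"  (infix "\<turnstile>\<^sub>m\<^sub>b\<^sub>C" 50)
  for \<Gamma> :: "fm set" where
  Premise: "\<phi> \<in> \<Gamma> \<Longrightarrow> \<Gamma> \<turnstile>\<^sub>m\<^sub>b\<^sub>C \<phi>"
| Axiom: "mbC_axiom \<phi> \<Longrightarrow> \<Gamma> \<turnstile>\<^sub>m\<^sub>b\<^sub>C \<phi>"
| MP: "\<Gamma> \<turnstile>\<^sub>m\<^sub>b\<^sub>C \<phi> \<Longrightarrow> \<Gamma> \<turnstile>\<^sub>m\<^sub>b\<^sub>C Imp \<phi> \<psi> \<Longrightarrow> \<Gamma> \<turnstile>\<^sub>m\<^sub>b\<^sub>C \<psi>"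


section \<open>Hyperoperations\<close>

definition hyperop1 :: "'a set \<Rightarrow> ('a \<Rightarrow> 'a set) \<Rightarrow> bool" where
  "hyperop1 P f \<longleftrightarrow> (\<forall>x\<in>P. f x \<subseteq> P \<and> f x \<noteq> {})"

definition hyperop2 :: "'a set \<Rightarrow> ('a \<Rightarrow> 'a \<Rightarrow> 'a set) \<Rightarrow> bool" where
  "hyperop2 P f \<longleftrightarrow> (\<forall>x\<in>P. \<forall>y\<in>P. f x y \<subseteq> P \<and> f x y \<noteq> {})"

definition ext1 :: "('a \<Rightarrow> 'a set) \<Rightarrow> 'a set \<Rightarrow> 'a set" where
  "ext1 f X = (\<Union>x\<in>X. f x)"

definition ext2 :: "('a \<Rightarrow> 'a \<Rightarrow> 'a set) \<Rightarrow> 'a set \<Rightarrow> 'a set \<Rightarrow> 'a set" where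
  "ext2 f X Y = (\<Union>x\<in>X. \<Union>y\<in>Y. f x y)"


section \<open>Hyperlattices\<close>

text \<open>
  The hyperlattice operations and the sets of top and bottom elements are determined by the
  preorder, so a structure carries only the preorder (as a relation on the carrier).
\<close>

record 'a preordered =
  carrier :: "'a set"
  le :: "('a \<times> 'a) set"

definition le_sets :: "('a, 'm) preordered_scheme \<Rightarrow> 'a set \<Rightarrow> 'a set \<Rightarrow> bool" where
  "le_sets B X Y \<longleftrightarrow> (\<forall>x\<in>X. \<forall>y\<in>Y. (x, y) \<in> le B)"

definition equiv_sets :: "('a, 'm) preordered_scheme \<Rightarrow> 'a set \<Rightarrow> 'a set \<Rightarrow> bool" where
  "equiv_sets B X Y \<longleftrightarrow> (\<forall>x\<in>X. \<forall>y\<in>Y. (x, y) \<in> le B \<and> (y, x) \<in> le B)"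

definition Mins :: "('a, 'm) preordered_scheme \<Rightarrow> 'a set \<Rightarrow> 'a set" where
  "Mins B X = {x \<in> X. le_sets B {x} X}"

definition Maxs :: "('a, 'm) preordered_scheme \<Rightarrow> 'a set \<Rightarrow> 'a set" where
  "Maxs B X = {x \<in> X. le_sets B X {x}}"

definition Ubs :: "('a, 'm) preordered_scheme \<Rightarrow> 'a set \<Rightarrow> 'a set" where
  "Ubs B X = {z \<in> carrier B. le_sets B X {z}}"

definition Lbs :: "('a, 'm) preordered_scheme \<Rightarrow> 'a set \<Rightarrow> 'a set" where
  "Lbs B X = {z \<in> carrier B. le_sets B {z} X}"

definition supremoid :: "('a, 'm) preordered_scheme \<Rightarrow> 'a \<Rightarrow> 'a \<Rightarrow> 'a set" where
  "supremoid B x y = Mins B (Ubs B {x, y})"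

definition infimoid :: "('a, 'm) preordered_scheme \<Rightarrow> 'a \<Rightarrow> 'a \<Rightarrow> 'a set" where
  "infimoid B x y = Maxs B (Lbs B {x, y})"

definition tops :: "('a, 'm) preordered_scheme \<Rightarrow> 'a set" where
  "tops B = Maxs B (carrier B)"

definition bots :: "('a, 'm) preordered_scheme \<Rightarrow> 'a set" where
  "bots B = Mins B (carrier B)"

text \<open>The operations extended to sets; an element is passed as a singleton.\<close>

abbreviation join_sets :: "'a set \<Rightarrow> ('a, 'm) preordered_scheme \<Rightarrow> 'a set \<Rightarrow> 'a set"
    ("_ \<squnion>[_] _" [66, 0, 66] 65) where
  "X \<squnion>[B] Y \<equiv> ext2 (supremoid B) X Y"

abbreviation meet_sets :: "'a set \<Rightarrow> ('a, 'm) preordered_scheme \<Rightarrow> 'a set \<Rightarrow> 'a set"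
    ("_ \<sqinter>[_] _" [71, 0, 71] 70) where
  "X \<sqinter>[B] Y \<equiv> ext2 (infimoid B) X Y"

abbreviation equiv_sets_infix :: "'a set \<Rightarrow> ('a, 'm) preordered_scheme \<Rightarrow> 'a set \<Rightarrow> bool"
    ("_ \<approx>[_] _" [51, 0, 51] 50) where
  "X \<approx>[B] Y \<equiv> equiv_sets B X Y"

definition hyperlattice :: "('a, 'm) preordered_scheme \<Rightarrow> bool" where
  "hyperlattice B \<longleftrightarrow>
     carrier B \<noteq> {} \<and> preorder_on (carrier B) (le B) \<and>
     (\<forall>x\<in>carrier B. \<forall>y\<in>carrier B. supremoid B x y \<noteq> {} \<and> infimoid B x y \<noteq> {})"

definition bounded_hyperlattice :: "('a, 'm) preordered_scheme \<Rightarrow> bool" where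
  "bounded_hyperlattice B \<longleftrightarrow> hyperlattice B \<and> tops B \<noteq> {} \<and> bots B \<noteq> {}"

definition distributive_hyperlattice :: "('a, 'm) preordered_scheme \<Rightarrow> bool" where
  "distributive_hyperlattice B \<longleftrightarrow> hyperlattice B \<and>
     (\<forall>x\<in>carrier B. \<forall>y\<in>carrier B. \<forall>z\<in>carrier B.
        {x} \<sqinter>[B] ({y} \<squnion>[B] {z}) = ({x} \<sqinter>[B] {y}) \<squnion>[B] ({x} \<sqinter>[B] {z}) \<and>
        {x} \<squnion>[B] ({y} \<sqinter>[B] {z}) = ({x} \<squnion>[B] {y}) \<sqinter>[B] ({x} \<squnion>[B] {z}))"


section \<open>Hyper Boolean algebras and hyper mbC algebras\<close>

record 'a hba = "'a preordered" +
  compl :: "'a \<Rightarrow> 'a set"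

definition is_HBA :: "('a, 'm) hba_scheme \<Rightarrow> bool" where
  "is_HBA B \<longleftrightarrow>
     bounded_hyperlattice B \<and> distributive_hyperlattice B \<and> hyperop1 (carrier B) (compl B) \<and>
     (\<forall>x\<in>carrier B. \<forall>y\<in>carrier B. {x} \<approx>[B] {y} \<longrightarrow> compl B x \<approx>[B] compl B y) \<and>
     (\<forall>x\<in>carrier B. x \<in> ext1 (compl B) (compl B x)) \<and>
     (\<forall>x\<in>carrier B. {x} \<squnion>[B] compl B x \<approx>[B] tops B) \<and>
     (\<forall>x\<in>carrier B. {x} \<sqinter>[B] compl B x \<approx>[B] bots B)"

definition himp :: "('a, 'm) hba_scheme \<Rightarrow> 'a \<Rightarrow> 'a \<Rightarrow> 'a set" where
  "himp B x y = compl B x \<squnion>[B] {y}"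

record 'a hmbca = "'a hba" +
  nng :: "'a \<Rightarrow> 'a set"
  cns :: "'a \<Rightarrow> 'a set"

definition is_HmbCA :: "('a, 'm) hmbca_scheme \<Rightarrow> bool" where
  "is_HmbCA A \<longleftrightarrow>
     is_HBA A \<and> hyperop1 (carrier A) (nng A) \<and> hyperop1 (carrier A) (cns A) \<and>
     (\<forall>x\<in>carrier A. \<forall>y\<in>nng A x. {x} \<squnion>[A] {y} \<approx>[A] tops A) \<and>
     (\<forall>x\<in>carrier A. \<forall>y\<in>nng A x. \<forall>z\<in>cns A x.
        ({x} \<sqinter>[A] {y}) \<sqinter>[A] {z} \<approx>[A] bots A)"


section \<open>Nmatrix semantics\<close>

record 'a sigma_alg =
  univ :: "'a set"
  conj_op :: "'a \<Rightarrow> 'a \<Rightarrow> 'a set"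
  disj_op :: "'a \<Rightarrow> 'a \<Rightarrow> 'a set"
  imp_op :: "'a \<Rightarrow> 'a \<Rightarrow> 'a set"
  neg_op :: "'a \<Rightarrow> 'a set"
  circ_op :: "'a \<Rightarrow> 'a set"

definition nmatrix :: "'a sigma_alg \<Rightarrow> 'a set \<Rightarrow> bool" where
  "nmatrix M D \<longleftrightarrow>
     hyperop2 (univ M) (conj_op M) \<and> hyperop2 (univ M) (disj_op M) \<and> hyperop2 (univ M) (imp_op M) \<and>
     hyperop1 (univ M) (neg_op M) \<and> hyperop1 (univ M) (circ_op M) \<and> D \<noteq> {} \<and> D \<subseteq> univ M"

definition valuation :: "'a sigma_alg \<Rightarrow> (fm \<Rightarrow> 'a) \<Rightarrow> bool" where
  "valuation M v \<longleftrightarrow>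
     (\<forall>\<phi>. v \<phi> \<in> univ M) \<and>
     (\<forall>\<phi> \<psi>. v (Conj \<phi> \<psi>) \<in> conj_op M (v \<phi>) (v \<psi>)) \<and>
     (\<forall>\<phi> \<psi>. v (Disj \<phi> \<psi>) \<in> disj_op M (v \<phi>) (v \<psi>)) \<and>
     (\<forall>\<phi> \<psi>. v (Imp \<phi> \<psi>) \<in> imp_op M (v \<phi>) (v \<psi>)) \<and>
     (\<forall>\<phi>. v (Neg \<phi>) \<in> neg_op M (v \<phi>)) \<and>
     (\<forall>\<phi>. v (Circ \<phi>) \<in> circ_op M (v \<phi>))"

definition entails :: "'a sigma_alg \<Rightarrow> 'a set \<Rightarrow> fm set \<Rightarrow> fm \<Rightarrow> bool" where
  "entails M D \<Gamma> \<phi> \<longleftrightarrow>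
     (\<forall>v. valuation M v \<longrightarrow> (\<forall>\<gamma>\<in>\<Gamma>. v \<gamma> \<in> D) \<longrightarrow> v \<phi> \<in> D)"

definition HmbCA_sigma :: "('a, 'm) hmbca_scheme \<Rightarrow> 'a sigma_alg" where
  "HmbCA_sigma A =
     \<lparr> univ = carrier A, conj_op = infimoid A, disj_op = supremoid A, imp_op = himp A,
       neg_op = nng A, circ_op = cns A \<rparr>"

definition swap_dom :: "('a, 'm) hba_scheme \<Rightarrow> ('a \<times> 'a \<times> 'a) set" where
  "swap_dom B =
     {(z1, z2, z3). z1 \<in> carrier B \<and> z2 \<in> carrier B \<and> z3 \<in> carrier B \<and>
        {z1} \<squnion>[B] {z2} \<approx>[B] tops B \<and>
        ({z1} \<sqinter>[B] {z2}) \<sqinter>[B] {z3} \<approx>[B] bots B}"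

definition swap_sigma :: "('a, 'm) hba_scheme \<Rightarrow> ('a \<times> 'a \<times> 'a) sigma_alg" where
  "swap_sigma B =
     \<lparr> univ = swap_dom B,
       conj_op = (\<lambda>z w. {u \<in> swap_dom B. fst u \<in> infimoid B (fst z) (fst w)}),
       disj_op = (\<lambda>z w. {u \<in> swap_dom B. fst u \<in> supremoid B (fst z) (fst w)}),
       imp_op = (\<lambda>z w. {u \<in> swap_dom B. fst u \<in> himp B (fst z) (fst w)}),
       neg_op = (\<lambda>z. {u \<in> swap_dom B. fst u = fst (snd z)}),
       circ_op = (\<lambda>z. {u \<in> swap_dom B. fst u = snd (snd z)}) \<rparr>"

definition swap_designated :: "('a, 'm) hba_scheme \<Rightarrow> ('a \<times> 'a \<times> 'a) set" where
  "swap_designated B = {z \<in> swap_dom B. fst z \<in> tops B}"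

text \<open>The pairs used in the two semantics are indeed Nmatrices.\<close>

lemma supremoid_hyperop: "hyperlattice B \<Longrightarrow> hyperop2 (carrier B) (supremoid B)"
  by (auto simp: hyperop2_def hyperlattice_def supremoid_def Mins_def Ubs_def)

lemma infimoid_hyperop: "hyperlattice B \<Longrightarrow> hyperop2 (carrier B) (infimoid B)"
  by (auto simp: hyperop2_def hyperlattice_def infimoid_def Maxs_def Lbs_def)

lemma himp_hyperop:
  assumes "is_HBA B" shows "hyperop2 (carrier B) (himp B)"
proof -
  have 1: "hyperop2 (carrier B) (supremoid B)" and 2: "hyperop1 (carrier B) (compl B)"
    using assms supremoid_hyperop[of B] by (simp_all add: is_HBA_def bounded_hyperlattice_def)
  show ?thesis
    unfolding hyperop2_def
  proof (intro ballI conjI)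
    fix x y assume xy: "x \<in> carrier B" "y \<in> carrier B"
    then have c: "compl B x \<subseteq> carrier B" "compl B x \<noteq> {}"
      using 2 by (simp_all add: hyperop1_def)
    with 1 xy show "himp B x y \<subseteq> carrier B"
      unfolding hyperop2_def himp_def ext2_def by blast
    from c obtain a where "a \<in> compl B x" "a \<in> carrier B" by blast
    with 1 xy(2) have "supremoid B a y \<noteq> {}" by (simp add: hyperop2_def)
    with \<open>a \<in> compl B x\<close> show "himp B x y \<noteq> {}" by (auto simp: himp_def ext2_def)
  qed
qed

lemma nmatrix_HmbCA:
  assumes "is_HmbCA A" shows "nmatrix (HmbCA_sigma A) (tops A)"
proof -
  have 1: "is_HBA A" "hyperlattice A" "tops A \<noteq> {}"
    using assms by (simp_all add: is_HmbCA_def is_HBA_def bounded_hyperlattice_def)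
  have 2: "tops A \<subseteq> carrier A" by (auto simp: tops_def Maxs_def)
  show ?thesis
    using assms 1 2 supremoid_hyperop[OF 1(2)] infimoid_hyperop[OF 1(2)] himp_hyperop[OF 1(1)]
    by (simp add: nmatrix_def HmbCA_sigma_def is_HmbCA_def)
qed

lemma swap_dom_extend:
  assumes B: "is_HBA B" and x: "x \<in> carrier B"
  shows "\<exists>u\<in>swap_dom B. fst u = x"
proof -
  have lat: "hyperlattice B" and pre: "preorder_on (carrier B) (le B)"
    using B by (simp_all add: is_HBA_def bounded_hyperlattice_def hyperlattice_def)
  obtain y where y: "y \<in> compl B x" "y \<in> carrier B"
    using B x unfolding is_HBA_def hyperop1_def by (meson all_not_in_conv subsetD)
  obtain z where z: "z \<in> bots B"
    using B by (simp only: is_HBA_def bounded_hyperlattice_def) blast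
  then have zc: "z \<in> carrier B" by (auto simp: bots_def Mins_def)
  have tr: "trans (le B)" using pre by (simp add: preorder_on_def)
  have "{x} \<squnion>[B] compl B x \<approx>[B] tops B"
    using B x by (simp only: is_HBA_def)
  then have "{x} \<squnion>[B] {y} \<approx>[B] tops B"
    using y(1) unfolding equiv_sets_def ext2_def by blast
  moreover have "({x} \<sqinter>[B] {y}) \<sqinter>[B] {z} \<approx>[B] bots B"
  proof -
    have "(c, b) \<in> le B \<and> (b, c) \<in> le B"
      if "c \<in> infimoid B w z" "b \<in> bots B" for c b w
    proof -
      have "(c, z) \<in> le B" "c \<in> carrier B"
        using that by (auto simp: infimoid_def Maxs_def Lbs_def le_sets_def)
      moreover have "(z, b) \<in> le B" using z that(2) by (auto simp: bots_def Mins_def le_sets_def)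
      moreover have "(b, c) \<in> le B"
        using that(2) \<open>c \<in> carrier B\<close> by (auto simp: bots_def Mins_def le_sets_def)
      ultimately show ?thesis using tr by (meson transD)
    qed
    then show ?thesis by (auto simp: equiv_sets_def ext2_def)
  qed
  ultimately have "(x, y, z) \<in> swap_dom B"
    using x y zc by (simp add: swap_dom_def)
  then show ?thesis by force
qed

lemma nmatrix_swap:
  assumes B: "is_HBA B" shows "nmatrix (swap_sigma B) (swap_designated B)"
proof -
  have lat: "hyperlattice B" using B by (simp add: is_HBA_def bounded_hyperlattice_def)
  have ne: "\<exists>u\<in>swap_dom B. fst u \<in> X" if "X \<subseteq> carrier B" "X \<noteq> {}" for X
  proof -
    from that obtain x where "x \<in> X" "x \<in> carrier B" by blast
    with swap_dom_extend[OF B] show ?thesis by blast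
  qed
  have lift2: "hyperop2 (swap_dom B) (\<lambda>z w. {u \<in> swap_dom B. fst u \<in> f (fst z) (fst w)})"
    if "hyperop2 (carrier B) f" for f
    unfolding hyperop2_def
  proof (intro ballI conjI)
    fix z w assume "z \<in> swap_dom B" "w \<in> swap_dom B"
    then have "fst z \<in> carrier B" "fst w \<in> carrier B" by (auto simp: swap_dom_def)
    then have "f (fst z) (fst w) \<subseteq> carrier B" "f (fst z) (fst w) \<noteq> {}"
      using that by (auto simp: hyperop2_def)
    from ne[OF this] show "{u \<in> swap_dom B. fst u \<in> f (fst z) (fst w)} \<noteq> {}" by blast
  qed auto
  have lift1: "hyperop1 (swap_dom B) (\<lambda>z. {u \<in> swap_dom B. fst u = f z})"
    if "\<And>z. z \<in> swap_dom B \<Longrightarrow> f z \<in> carrier B" for f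
    unfolding hyperop1_def
  proof (intro ballI conjI)
    fix z assume "z \<in> swap_dom B"
    from swap_dom_extend[OF B that[OF this]]
    show "{u \<in> swap_dom B. fst u = f z} \<noteq> {}" by blast
  qed auto
  have "hyperop1 (swap_dom B) (\<lambda>z. {u \<in> swap_dom B. fst u = fst (snd z)})"
    by (rule lift1) (auto simp: swap_dom_def)
  moreover have "hyperop1 (swap_dom B) (\<lambda>z. {u \<in> swap_dom B. fst u = snd (snd z)})"
    by (rule lift1) (auto simp: swap_dom_def)
  moreover have "swap_designated B \<noteq> {}"
  proof -
    have "tops B \<noteq> {}" using B by (simp add: is_HBA_def bounded_hyperlattice_def)
    moreover have "tops B \<subseteq> carrier B" by (auto simp: tops_def Maxs_def)
    ultimately obtain u where "u \<in> swap_dom B" "fst u \<in> tops B" using ne[of "tops B"] by blast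
    then have "u \<in> swap_designated B" by (simp add: swap_designated_def)
    then show ?thesis by blast
  qed
  ultimately show ?thesis
    using lift2[OF supremoid_hyperop[OF lat]] lift2[OF infimoid_hyperop[OF lat]]
      lift2[OF himp_hyperop[OF B]]
    by (simp add: nmatrix_def swap_sigma_def swap_designated_def)
qed

text \<open>
  HOL cannot quantify over types inside a formula, so the two semantical consequence relations
  are indexed by the type from which the carriers are drawn; the carriers themselves range over
  arbitrary nonempty subsets of that type. Over a small finite type (such as \<^typ>\<open>unit\<close>) there
  may be too few structures for completeness. Over an infinite type there is room for an isomorphic
  copy of every countable structure, hence of the Lindenbaum structures.
\<close>

definition HmbCA_consequence :: "'a itself \<Rightarrow> fm set \<Rightarrow> fm \<Rightarrow> bool" where
  "HmbCA_consequence TYPE('a) \<Gamma> \<phi> \<longleftrightarrow>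
     (\<forall>A :: 'a hmbca. is_HmbCA A \<longrightarrow> entails (HmbCA_sigma A) (tops A) \<Gamma> \<phi>)"

definition HSW_consequence :: "'a itself \<Rightarrow> fm set \<Rightarrow> fm \<Rightarrow> bool" where
  "HSW_consequence TYPE('a) \<Gamma> \<phi> \<longleftrightarrow>
     (\<forall>B :: 'a hba. is_HBA B \<longrightarrow> entails (swap_sigma B) (swap_designated B) \<Gamma> \<phi>)"

end

theory Submission
  imports Defs
begin

text \<open>
  Both semantics are governed by one notion. A map \<open>w\<close> from formulas into a hyper Boolean algebra
  is called an HBA valuation if it respects conjunction, disjunction and implication up to the
  choice allowed by the hyperoperations and if \<open>w a\<close>, \<open>w (Neg a)\<close>, \<open>w (Circ a)\<close> satisfy the two
  constraints that tie them together. A valuation over a hyper mbC algebra is of this kind, and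
  valuations over the swap structure are exactly the triples
  \<open>(w a, w (Neg a), w (Circ a))\<close> of such a \<open>w\<close>.

  Soundness. In an HBA every element of \<open>x \<multimap> y\<close> is a relative pseudocomplement:
  \<open>c \<preceq> d\<close> holds iff every lower bound of \<open>c\<close> and \<open>x\<close> is below \<open>y\<close> (lemma \<open>himp_residuation\<close>, the only
  place where distributivity and the complement are needed together). Reading \<open>t \<preceq> w a\<close> as ``\<open>t\<close>
  forces \<open>a\<close>'' therefore turns implication and conjunction into their Kripke clauses, and each axiom is
  forced by every element; the classical axiom \<open>a \<or> (a \<rightarrow> b)\<close> holds because a complement of \<open>w a\<close> is
  below \<open>w (a \<rightarrow> b)\<close>.

  Completeness. If \<open>\<phi>\<close> is not derivable from \<open>\<Gamma>\<close>, then \<open>\<Gamma>\<close> extends to a set \<open>\<Delta>\<close> that is maximal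
  among the sets not deriving \<open>\<phi>\<close>. Membership in \<open>\<Delta>\<close> is a two-valued truth assignment in which \<open>\<not> a\<close>
  and \<open>\<circ> a\<close> are constrained but not determined by \<open>a\<close>. To read it as a valuation, split a set into a
  class \<open>T\<close> of mutually equivalent tops and its complement, a class of mutually equivalent bottoms; this
  is an HBA whose quotient is the two-element Boolean algebra. For swap structures this suffices. In a
  hyper mbC algebra the constraint on \<open>\<not> x\<close> and \<open>\<circ> x\<close> must hold for all pairs of values, so one true
  element cannot serve both for an \<open>a\<close> with \<open>\<not> a\<close> true and for an \<open>a\<close> with \<open>\<circ> a\<close> true. Two equivalent
  tops are enough: one for the formulas that hold together with their negation, one for all other true
  formulas. One bottom and these two tops already carry the countermodel; on a larger
  type every further element is one more bottom.
\<close>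

section \<open>HBA valuations\<close>

definition hba_valuation :: "('a, 'm) hba_scheme \<Rightarrow> (fm \<Rightarrow> 'a) \<Rightarrow> bool" where
  "hba_valuation B w \<longleftrightarrow>
     (\<forall>a. w a \<in> carrier B) \<and>
     (\<forall>a b. w (Conj a b) \<in> infimoid B (w a) (w b)) \<and>
     (\<forall>a b. w (Disj a b) \<in> supremoid B (w a) (w b)) \<and>
     (\<forall>a b. w (Imp a b) \<in> himp B (w a) (w b)) \<and>
     (\<forall>a. {w a} \<squnion>[B] {w (Neg a)} \<approx>[B] tops B) \<and>
     (\<forall>a. ({w a} \<sqinter>[B] {w (Neg a)}) \<sqinter>[B] {w (Circ a)} \<approx>[B] bots B)"

lemma HmbCA_valuation_imp_hba_valuation:
  assumes "is_HmbCA A" and "valuation (HmbCA_sigma A) v"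
  shows "hba_valuation A v"
  using assms by (simp add: is_HmbCA_def valuation_def HmbCA_sigma_def hba_valuation_def)

text \<open>
  The second and third components of a swap value are the first components of the values of the
  negation and of the consistency statement, so a swap valuation is determined by its first component.
\<close>

lemma swap_valuation_imp_hba_valuation:
  assumes v: "valuation (swap_sigma B) v"
  shows "hba_valuation B (\<lambda>a. fst (v a))"
proof -
  have dom: "v a \<in> swap_dom B" for a
    using v by (simp add: valuation_def swap_sigma_def)
  have comps: "v a = (fst (v a), fst (v (Neg a)), fst (v (Circ a)))" for a
    using v by (simp add: valuation_def swap_sigma_def prod_eq_iff)
  have "(fst (v a), fst (v (Neg a)), fst (v (Circ a))) \<in> swap_dom B" for a
    using dom[of a] comps[of a] by simp
  then show ?thesis
    using v by (simp add: hba_valuation_def valuation_def swap_sigma_def swap_dom_def)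
qed

lemma hba_valuation_imp_swap_valuation:
  assumes "hba_valuation B w"
  shows "valuation (swap_sigma B) (\<lambda>a. (w a, w (Neg a), w (Circ a)))"
  using assms by (simp add: hba_valuation_def valuation_def swap_sigma_def swap_dom_def)


section \<open>Hyper Boolean algebras as preorders\<close>

lemma infimoid_iff:
  "m \<in> infimoid B x y \<longleftrightarrow>
     m \<in> carrier B \<and> (m, x) \<in> le B \<and> (m, y) \<in> le B \<and>
     (\<forall>t\<in>carrier B. (t, x) \<in> le B \<longrightarrow> (t, y) \<in> le B \<longrightarrow> (t, m) \<in> le B)"
  by (auto simp: infimoid_def Maxs_def Lbs_def le_sets_def)

lemma supremoid_iff:
  "m \<in> supremoid B x y \<longleftrightarrow>
     m \<in> carrier B \<and> (x, m) \<in> le B \<and> (y, m) \<in> le B \<and>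
     (\<forall>t\<in>carrier B. (x, t) \<in> le B \<longrightarrow> (y, t) \<in> le B \<longrightarrow> (m, t) \<in> le B)"
  by (auto simp: supremoid_def Mins_def Ubs_def le_sets_def)

lemma tops_iff: "x \<in> tops B \<longleftrightarrow> x \<in> carrier B \<and> (\<forall>t\<in>carrier B. (t, x) \<in> le B)"
  by (auto simp: tops_def Maxs_def le_sets_def)

lemma bots_iff: "x \<in> bots B \<longleftrightarrow> x \<in> carrier B \<and> (\<forall>t\<in>carrier B. (x, t) \<in> le B)"
  by (auto simp: bots_def Mins_def le_sets_def)

locale hyper_boolean_algebra =
  fixes B :: "('a, 'm) hba_scheme"
  assumes HBA: "is_HBA B"
begin

abbreviation leq :: "'a \<Rightarrow> 'a \<Rightarrow> bool"  (infix "\<preceq>" 50) where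
  "x \<preceq> y \<equiv> (x, y) \<in> le B"

lemma preorder: "preorder_on (carrier B) (le B)"
  using HBA by (simp add: is_HBA_def bounded_hyperlattice_def hyperlattice_def)

lemma le_trans [trans]: "x \<preceq> y \<Longrightarrow> y \<preceq> z \<Longrightarrow> x \<preceq> z"
  using preorder unfolding preorder_on_def by (meson transD)

lemma le_refl: "x \<in> carrier B \<Longrightarrow> x \<preceq> x"
  using preorder unfolding preorder_on_def by (meson refl_onD)

lemma infimoid_nonempty: "x \<in> carrier B \<Longrightarrow> y \<in> carrier B \<Longrightarrow> infimoid B x y \<noteq> {}"
  and supremoid_nonempty: "x \<in> carrier B \<Longrightarrow> y \<in> carrier B \<Longrightarrow> supremoid B x y \<noteq> {}"
  using HBA by (auto simp: is_HBA_def bounded_hyperlattice_def hyperlattice_def)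

lemma tops_nonempty: "tops B \<noteq> {}" and bots_nonempty: "bots B \<noteq> {}"
  using HBA by (simp_all add: is_HBA_def bounded_hyperlattice_def)

lemma equiv_tops_imp_above:
  assumes "X \<approx>[B] tops B" "x \<in> X" "t \<in> carrier B"
  shows "t \<preceq> x"
proof -
  obtain u where u: "u \<in> tops B"
    using tops_nonempty by blast
  then have "t \<preceq> u" "u \<preceq> x"
    using assms by (auto simp: tops_iff equiv_sets_def)
  then show ?thesis by (rule le_trans)
qed

lemma equiv_bots_imp_below:
  assumes "X \<approx>[B] bots B" "x \<in> X" "t \<in> carrier B"
  shows "x \<preceq> t"
proof -
  obtain u where u: "u \<in> bots B"
    using bots_nonempty by blast
  then have "x \<preceq> u" "u \<preceq> t"
    using assms by (auto simp: bots_iff equiv_sets_def)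
  then show ?thesis by (rule le_trans)
qed

lemma
  assumes "x \<in> carrier B" "n \<in> compl B x"
  shows compl_carrier: "n \<in> carrier B"
    and sup_compl_above: "\<And>s t. s \<in> supremoid B x n \<Longrightarrow> t \<in> carrier B \<Longrightarrow> t \<preceq> s"
    and inf_compl_below: "\<And>p t. p \<in> infimoid B x n \<Longrightarrow> t \<in> carrier B \<Longrightarrow> p \<preceq> t"
proof -
  show "n \<in> carrier B"
    using HBA assms by (auto simp: is_HBA_def hyperop1_def)
next
  fix s t assume s: "s \<in> supremoid B x n" and t: "t \<in> carrier B"
  have "{x} \<squnion>[B] compl B x \<approx>[B] tops B"
    using HBA assms(1) unfolding is_HBA_def by blast
  moreover have "s \<in> {x} \<squnion>[B] compl B x"
    using s assms(2) by (auto simp: ext2_def)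
  ultimately show "t \<preceq> s" using t by (rule equiv_tops_imp_above)
next
  fix p t assume p: "p \<in> infimoid B x n" and t: "t \<in> carrier B"
  have "{x} \<sqinter>[B] compl B x \<approx>[B] bots B"
    using HBA assms(1) unfolding is_HBA_def by blast
  moreover have "p \<in> {x} \<sqinter>[B] compl B x"
    using p assms(2) by (auto simp: ext2_def)
  ultimately show "p \<preceq> t" using t by (rule equiv_bots_imp_below)
qed

lemma infimoid_distrib:
  assumes "x \<in> carrier B" "y \<in> carrier B" "z \<in> carrier B"
    and "s \<in> supremoid B y z" and "m \<in> infimoid B x s"
  obtains p q where "p \<in> infimoid B x y" "q \<in> infimoid B x z" "m \<in> supremoid B p q"
proof -
  have "{x} \<sqinter>[B] ({y} \<squnion>[B] {z}) = ({x} \<sqinter>[B] {y}) \<squnion>[B] ({x} \<sqinter>[B] {z})"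
    using HBA assms(1-3) unfolding is_HBA_def distributive_hyperlattice_def by blast
  moreover have "m \<in> {x} \<sqinter>[B] ({y} \<squnion>[B] {z})"
    using assms(4,5) by (auto simp: ext2_def)
  ultimately show ?thesis
    using that by (auto simp: ext2_def)
qed

lemma himp_iff: "d \<in> himp B x y \<longleftrightarrow> (\<exists>n\<in>compl B x. d \<in> supremoid B n y)"
  by (simp add: himp_def ext2_def)

text \<open>
  The usual Boolean computations \<open>x \<and> (\<not> x \<or> y) = x \<and> y\<close> and
  \<open>c = (c \<and> x) \<or> (c \<and> \<not> x)\<close> go through with arbitrary representatives of the values of the
  hyperoperations.
\<close>

lemma himp_residuation:
  assumes x: "x \<in> carrier B" and y: "y \<in> carrier B" and c: "c \<in> carrier B"
    and d: "d \<in> himp B x y"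
  shows "c \<preceq> d \<longleftrightarrow> (\<forall>t\<in>carrier B. t \<preceq> c \<longrightarrow> t \<preceq> x \<longrightarrow> t \<preceq> y)"
proof -
  obtain n where n: "n \<in> compl B x" and dn: "d \<in> supremoid B n y"
    using d by (auto simp: himp_iff)
  have nc: "n \<in> carrier B" using compl_carrier[OF x n] .
  have dc: "d \<in> carrier B" and nd: "n \<preceq> d" and yd: "y \<preceq> d"
    using dn by (auto simp: supremoid_iff)
  show ?thesis
  proof (intro iffI ballI impI)
    fix t assume "c \<preceq> d" "t \<in> carrier B" "t \<preceq> c" "t \<preceq> x"
    obtain m where m: "m \<in> infimoid B x d"
      using infimoid_nonempty[OF x dc] by blast
    obtain p q where p: "p \<in> infimoid B x n" and q: "q \<in> infimoid B x y"
      and pq: "m \<in> supremoid B p q"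
      using infimoid_distrib[OF x nc y dn m] .
    have qc: "q \<in> carrier B" and qy: "q \<preceq> y"
      using q by (auto simp: infimoid_iff)
    have "t \<preceq> d" using \<open>t \<preceq> c\<close> \<open>c \<preceq> d\<close> by (rule le_trans)
    then have "t \<preceq> m"
      using m \<open>t \<in> carrier B\<close> \<open>t \<preceq> x\<close> by (auto simp: infimoid_iff)
    also have "m \<preceq> q"
      using pq inf_compl_below[OF x n p qc] le_refl[OF qc] qc by (auto simp: supremoid_iff)
    also note qy
    finally show "t \<preceq> y" .
  next
    assume below: "\<forall>t\<in>carrier B. t \<preceq> c \<longrightarrow> t \<preceq> x \<longrightarrow> t \<preceq> y"
    obtain s where s: "s \<in> supremoid B x n"
      using supremoid_nonempty[OF x nc] by blast
    then have sc: "s \<in> carrier B" by (simp add: supremoid_iff)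
    obtain m where m: "m \<in> infimoid B c s"
      using infimoid_nonempty[OF c sc] by blast
    obtain p q where p: "p \<in> infimoid B c x" and q: "q \<in> infimoid B c n"
      and pq: "m \<in> supremoid B p q"
      using infimoid_distrib[OF c x nc s m] .
    have "p \<preceq> y" using below p by (auto simp: infimoid_iff)
    then have pd: "p \<preceq> d" using yd by (rule le_trans)
    have "q \<preceq> n" using q by (auto simp: infimoid_iff)
    then have qd: "q \<preceq> d" using nd by (rule le_trans)
    have "c \<preceq> m"
      using m c le_refl[OF c] sup_compl_above[OF x n s c] by (auto simp: infimoid_iff)
    also have "m \<preceq> d" using pq pd qd dc by (auto simp: supremoid_iff)
    finally show "c \<preceq> d" .
  qed
qed

end


section \<open>Soundness\<close>

locale hba_valued = hyper_boolean_algebra +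
  fixes w :: "fm \<Rightarrow> 'a"
  assumes w: "hba_valuation B w"
begin

abbreviation forces :: "'a \<Rightarrow> fm \<Rightarrow> bool"  (infix "\<tturnstile>" 50) where
  "t \<tturnstile> a \<equiv> t \<preceq> w a"

lemma w_carrier: "w a \<in> carrier B"
  using w by (simp add: hba_valuation_def)

lemma forces_Conj: "t \<in> carrier B \<Longrightarrow> t \<tturnstile> Conj a b \<longleftrightarrow> t \<tturnstile> a \<and> t \<tturnstile> b"
proof -
  assume t: "t \<in> carrier B"
  have "w (Conj a b) \<in> infimoid B (w a) (w b)"
    using w by (simp add: hba_valuation_def)
  then show ?thesis
    using t le_trans by (auto simp: infimoid_iff)
qed

lemma forces_Imp:
  "t \<in> carrier B \<Longrightarrow> t \<tturnstile> Imp a b \<longleftrightarrow> (\<forall>s\<in>carrier B. s \<preceq> t \<longrightarrow> s \<tturnstile> a \<longrightarrow> s \<tturnstile> b)"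
  using w himp_residuation[OF w_carrier w_carrier] by (simp add: hba_valuation_def)

text \<open>
  Forcing a disjunction has no Kripke clause here, since an element need not be join-prime;
  disjunction is handled by its universal property.
\<close>

lemma Disj_upper: "w a \<tturnstile> Disj a b" "w b \<tturnstile> Disj a b"
  and Disj_least: "z \<in> carrier B \<Longrightarrow> w a \<preceq> z \<Longrightarrow> w b \<preceq> z \<Longrightarrow> w (Disj a b) \<preceq> z"
proof -
  have "w (Disj a b) \<in> supremoid B (w a) (w b)"
    using w by (simp add: hba_valuation_def)
  then show "w a \<tturnstile> Disj a b" "w b \<tturnstile> Disj a b"
    "z \<in> carrier B \<Longrightarrow> w a \<preceq> z \<Longrightarrow> w b \<preceq> z \<Longrightarrow> w (Disj a b) \<preceq> z"
    by (auto simp: supremoid_iff)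
qed

text \<open>
  To eliminate a disjunction, exchange hypotheses: \<open>a\<close> and \<open>b\<close> are both below an element of
  \<open>t \<multimap> w c\<close>, and so is their supremum. This is where the existence of relative pseudocomplements
  replaces distributivity.
\<close>

lemma forces_Disj_elim:
  assumes t: "t \<in> carrier B" and ab: "t \<tturnstile> Disj a b"
    and a: "t \<tturnstile> Imp a c" and b: "t \<tturnstile> Imp b c"
  shows "t \<tturnstile> c"
proof -
  obtain d where d: "d \<in> himp B t (w c)"
    using himp_hyperop[OF HBA] t w_carrier unfolding hyperop2_def by blast
  then have dc: "d \<in> carrier B" by (auto simp: himp_iff supremoid_iff)
  note res = himp_residuation[OF t w_carrier _ d]
  have "w a \<preceq> d" "w b \<preceq> d"
    using a b t by (auto simp: res w_carrier forces_Imp)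
  then have "w (Disj a b) \<preceq> d" using dc by (intro Disj_least)
  with ab have "t \<preceq> d" by (rule le_trans)
  then show ?thesis using res[OF t] t le_refl by blast
qed

lemma forces_excluded_middle:
  assumes t: "t \<in> carrier B"
  shows "t \<tturnstile> Disj a (Imp a b)" and "t \<tturnstile> Disj a (Neg a)"
proof -
  obtain n where n: "n \<in> compl B (w a)" and "w (Imp a b) \<in> supremoid B n (w b)"
    using w unfolding hba_valuation_def himp_iff by blast
  then have "n \<tturnstile> Imp a b" by (simp add: supremoid_iff)
  then have "n \<tturnstile> Disj a (Imp a b)" using Disj_upper(2) by (rule le_trans)
  moreover obtain s where s: "s \<in> supremoid B (w a) n"
    using supremoid_nonempty[OF w_carrier compl_carrier[OF w_carrier n]] by blast
  ultimately have "s \<tturnstile> Disj a (Imp a b)"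
    using Disj_upper(1) w_carrier by (auto simp: supremoid_iff)
  with sup_compl_above[OF w_carrier n s t] show "t \<tturnstile> Disj a (Imp a b)"
    by (rule le_trans)
next
  have "{w a} \<squnion>[B] {w (Neg a)} \<approx>[B] tops B" "w (Disj a (Neg a)) \<in> {w a} \<squnion>[B] {w (Neg a)}"
    using w by (simp_all add: hba_valuation_def ext2_def)
  then show "t \<tturnstile> Disj a (Neg a)" using t by (rule equiv_tops_imp_above)
qed

lemma forces_gentle_explosion:
  assumes t: "t \<in> carrier B" and "t \<tturnstile> Circ a" "t \<tturnstile> a" "t \<tturnstile> Neg a"
  shows "t \<tturnstile> b"
proof -
  obtain m where m: "m \<in> infimoid B (w a) (w (Neg a))"
    using infimoid_nonempty[OF w_carrier w_carrier] by blast
  then have mc: "m \<in> carrier B" by (simp add: infimoid_iff)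
  obtain k where k: "k \<in> infimoid B m (w (Circ a))"
    using infimoid_nonempty[OF mc w_carrier] by blast
  have "t \<preceq> k" using assms m k by (auto simp: infimoid_iff)
  moreover have "k \<preceq> w b"
  proof (rule equiv_bots_imp_below)
    show "({w a} \<sqinter>[B] {w (Neg a)}) \<sqinter>[B] {w (Circ a)} \<approx>[B] bots B"
      using w by (simp add: hba_valuation_def)
    show "k \<in> ({w a} \<sqinter>[B] {w (Neg a)}) \<sqinter>[B] {w (Circ a)}"
      using m k by (auto simp: ext2_def)
  qed (rule w_carrier)
  ultimately show ?thesis by (rule le_trans)
qed

lemma forces_axiom:
  assumes "mbC_axiom a" and t: "t \<in> carrier B"
  shows "t \<tturnstile> a"
  using assms(1)
proof cases
  case (Ax1 a b)
  then show ?thesis using t by (auto simp: forces_Imp intro: le_trans)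
next
  case (Ax2 a b c)
  show ?thesis unfolding Ax2
  proof (subst forces_Imp[OF t], intro ballI impI)
    fix r assume r: "r \<in> carrier B" and abc: "r \<tturnstile> Imp a (Imp b c)"
    show "r \<tturnstile> Imp (Imp a b) (Imp a c)"
    proof (subst forces_Imp[OF r], intro ballI impI)
      fix s assume s: "s \<in> carrier B" "s \<preceq> r" and ab: "s \<tturnstile> Imp a b"
      show "s \<tturnstile> Imp a c"
      proof (subst forces_Imp[OF s(1)], intro ballI impI)
        fix u assume u: "u \<in> carrier B" "u \<preceq> s" and a: "u \<tturnstile> a"
        have "u \<preceq> r" using u(2) s(2) by (rule le_trans)
        then have "u \<tturnstile> Imp b c" using abc a u by (simp add: forces_Imp[OF r])
        moreover have "u \<tturnstile> b" using ab a u by (simp add: forces_Imp[OF s(1)])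
        ultimately show "u \<tturnstile> c" using le_refl[OF u(1)] u(1) by (simp add: forces_Imp)
      qed
    qed
  qed
next
  case (Ax3 a b)
  then show ?thesis using t by (auto simp: forces_Imp forces_Conj intro: le_trans)
next
  case (Ax4 a b)
  then show ?thesis using t by (simp add: forces_Imp forces_Conj)
next
  case (Ax5 a b)
  then show ?thesis using t by (simp add: forces_Imp forces_Conj)
next
  case (Ax6 a b)
  then show ?thesis using t Disj_upper(1) by (auto simp: forces_Imp intro: le_trans)
next
  case (Ax7 b a)
  then show ?thesis using t Disj_upper(2) by (auto simp: forces_Imp intro: le_trans)
next
  case (Ax8 a c b)
  show ?thesis unfolding Ax8
  proof (subst forces_Imp[OF t], intro ballI impI)
    fix r assume r: "r \<in> carrier B" and ac: "r \<tturnstile> Imp a c"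
    show "r \<tturnstile> Imp (Imp b c) (Imp (Disj a b) c)"
    proof (subst forces_Imp[OF r], intro ballI impI)
      fix s assume s: "s \<in> carrier B" "s \<preceq> r" and bc: "s \<tturnstile> Imp b c"
      show "s \<tturnstile> Imp (Disj a b) c"
      proof (subst forces_Imp[OF s(1)], intro ballI impI)
        fix u assume u: "u \<in> carrier B" "u \<preceq> s" and ab: "u \<tturnstile> Disj a b"
        have "u \<preceq> r" using u(2) s(2) by (rule le_trans)
        then have "u \<tturnstile> Imp a c" using ac by (rule le_trans)
        moreover have "u \<tturnstile> Imp b c" using u(2) bc by (rule le_trans)
        ultimately show "u \<tturnstile> c" using forces_Disj_elim[OF u(1) ab] by blast
      qed
    qed
  qed
next
  case (Ax9 a b)
  then show ?thesis using t forces_excluded_middle by simp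
next
  case (Ax10 a)
  then show ?thesis using t forces_excluded_middle by simp
next
  case (bc1 a b)
  show ?thesis unfolding bc1
  proof (subst forces_Imp[OF t], intro ballI impI)
    fix r assume r: "r \<in> carrier B" and circ: "r \<tturnstile> Circ a"
    show "r \<tturnstile> Imp a (Imp (Neg a) b)"
    proof (subst forces_Imp[OF r], intro ballI impI)
      fix s assume s: "s \<in> carrier B" "s \<preceq> r" and a: "s \<tturnstile> a"
      show "s \<tturnstile> Imp (Neg a) b"
      proof (subst forces_Imp[OF s(1)], intro ballI impI)
        fix u assume u: "u \<in> carrier B" "u \<preceq> s" and neg: "u \<tturnstile> Neg a"
        have "u \<preceq> r" using u(2) s(2) by (rule le_trans)
        then have "u \<tturnstile> Circ a" using circ by (rule le_trans)
        moreover have "u \<tturnstile> a" using u(2) a by (rule le_trans)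
        ultimately show "u \<tturnstile> b" using forces_gentle_explosion u(1) neg by blast
      qed
    qed
  qed
qed

lemma derivable_imp_tops:
  assumes "\<Gamma> \<turnstile>\<^sub>m\<^sub>b\<^sub>C a" and "\<And>g. g \<in> \<Gamma> \<Longrightarrow> w g \<in> tops B"
  shows "w a \<in> tops B"
  using assms(1)
proof induction
  case (Premise a)
  then show ?case by (rule assms(2))
next
  case (Axiom a)
  then show ?case using forces_axiom by (simp add: tops_iff w_carrier)
next
  case (MP a b)
  have "t \<tturnstile> b" if t: "t \<in> carrier B" for t
  proof -
    have "t \<tturnstile> a" "t \<tturnstile> Imp a b" using MP.IH t by (simp_all add: tops_iff)
    then show ?thesis using forces_Imp t le_refl by blast
  qed
  then show ?case by (simp add: tops_iff w_carrier)
qed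

end

lemma HmbCA_soundness:
  assumes "\<Gamma> \<turnstile>\<^sub>m\<^sub>b\<^sub>C \<phi>"
  shows "HmbCA_consequence TYPE('a) \<Gamma> \<phi>"
  unfolding HmbCA_consequence_def entails_def
proof (intro allI impI)
  fix A :: "'a hmbca" and v
  assume A: "is_HmbCA A" and v: "valuation (HmbCA_sigma A) v" and \<Gamma>: "\<forall>\<gamma>\<in>\<Gamma>. v \<gamma> \<in> tops A"
  interpret hba_valued A v
    using A HmbCA_valuation_imp_hba_valuation[OF A v]
    by unfold_locales (simp_all add: is_HmbCA_def)
  show "v \<phi> \<in> tops A" using derivable_imp_tops[OF assms] \<Gamma> by blast
qed

lemma HSW_soundness:
  assumes "\<Gamma> \<turnstile>\<^sub>m\<^sub>b\<^sub>C \<phi>"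
  shows "HSW_consequence TYPE('a) \<Gamma> \<phi>"
  unfolding HSW_consequence_def entails_def
proof (intro allI impI)
  fix B :: "'a hba" and v
  assume B: "is_HBA B" and v: "valuation (swap_sigma B) v"
    and \<Gamma>: "\<forall>\<gamma>\<in>\<Gamma>. v \<gamma> \<in> swap_designated B"
  interpret hba_valued B "\<lambda>a. fst (v a)"
    using B swap_valuation_imp_hba_valuation[OF v] by unfold_locales
  have "fst (v \<phi>) \<in> tops B"
    using derivable_imp_tops[OF assms] \<Gamma> by (simp add: swap_designated_def)
  moreover have "v \<phi> \<in> swap_dom B"
    using v by (simp add: valuation_def swap_sigma_def)
  ultimately show "v \<phi> \<in> swap_designated B"
    by (simp add: swap_designated_def)
qed


section \<open>Maximal sets not deriving a formula\<close>

lemma derivable_refl: "\<Gamma> \<turnstile>\<^sub>m\<^sub>b\<^sub>C Imp a a"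
proof -
  have "\<Gamma> \<turnstile>\<^sub>m\<^sub>b\<^sub>C Imp (Imp a (Imp (Imp a a) a)) (Imp (Imp a (Imp a a)) (Imp a a))"
    "\<Gamma> \<turnstile>\<^sub>m\<^sub>b\<^sub>C Imp a (Imp (Imp a a) a)" "\<Gamma> \<turnstile>\<^sub>m\<^sub>b\<^sub>C Imp a (Imp a a)"
    by (rule mbC_derivable.Axiom, rule Ax1 Ax2)+
  then show ?thesis using mbC_derivable.MP by blast
qed

lemma derivable_weaken: "\<Gamma> \<turnstile>\<^sub>m\<^sub>b\<^sub>C b \<Longrightarrow> \<Gamma> \<turnstile>\<^sub>m\<^sub>b\<^sub>C Imp a b"
  by (rule mbC_derivable.MP[OF _ mbC_derivable.Axiom[OF Ax1]])

lemma deduction_theorem: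
  assumes "insert a \<Gamma> \<turnstile>\<^sub>m\<^sub>b\<^sub>C b"
  shows "\<Gamma> \<turnstile>\<^sub>m\<^sub>b\<^sub>C Imp a b"
  using assms
proof induction
  case (Premise b)
  then show ?case
    using derivable_refl derivable_weaken mbC_derivable.Premise by blast
next
  case (Axiom b)
  then show ?case using derivable_weaken mbC_derivable.Axiom by blast
next
  case (MP b c)
  have "\<Gamma> \<turnstile>\<^sub>m\<^sub>b\<^sub>C Imp (Imp a b) (Imp a c)"
    using MP.IH(2) mbC_derivable.Axiom[OF Ax2] by (rule mbC_derivable.MP)
  with MP.IH(1) show ?case by (rule mbC_derivable.MP)
qed

lemma derivable_mono:
  assumes "\<Gamma> \<turnstile>\<^sub>m\<^sub>b\<^sub>C a" and "\<Gamma> \<subseteq> \<Delta>"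
  shows "\<Delta> \<turnstile>\<^sub>m\<^sub>b\<^sub>C a"
  using assms by (induction) (auto intro: mbC_derivable.intros)

text \<open>Derivations use finitely many premises, hence only one member of a chain.\<close>

lemma derivable_Union_chain:
  assumes "\<Union>C \<turnstile>\<^sub>m\<^sub>b\<^sub>C a" and chain: "subset.chain S C" and "C \<noteq> {}"
  shows "\<exists>\<Delta>\<in>C. \<Delta> \<turnstile>\<^sub>m\<^sub>b\<^sub>C a"
  using assms(1)
proof induction
  case (Premise a)
  then show ?case using mbC_derivable.Premise by blast
next
  case (Axiom a)
  then show ?case using \<open>C \<noteq> {}\<close> mbC_derivable.Axiom by blast
next
  case (MP a b)
  then obtain \<Delta> \<Delta>' where D: "\<Delta> \<in> C" "\<Delta> \<turnstile>\<^sub>m\<^sub>b\<^sub>C a" "\<Delta>' \<in> C" "\<Delta>' \<turnstile>\<^sub>m\<^sub>b\<^sub>C Imp a b" by blast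
  have "\<Delta> \<subseteq> \<Delta>' \<or> \<Delta>' \<subseteq> \<Delta>"
    using chain D by (auto simp: subset_chain_def)
  then show ?case
    using D derivable_mono mbC_derivable.MP by metis
qed

definition saturated :: "fm \<Rightarrow> fm set \<Rightarrow> bool" where
  "saturated \<phi> \<Delta> \<longleftrightarrow> \<not> \<Delta> \<turnstile>\<^sub>m\<^sub>b\<^sub>C \<phi> \<and> (\<forall>a. a \<notin> \<Delta> \<longrightarrow> insert a \<Delta> \<turnstile>\<^sub>m\<^sub>b\<^sub>C \<phi>)"

lemma saturated_extension_exists:
  assumes "\<not> \<Gamma> \<turnstile>\<^sub>m\<^sub>b\<^sub>C \<phi>"
  obtains \<Delta> where "\<Gamma> \<subseteq> \<Delta>" "saturated \<phi> \<Delta>"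
proof -
  define S where "S = {\<Delta>. \<Gamma> \<subseteq> \<Delta> \<and> \<not> \<Delta> \<turnstile>\<^sub>m\<^sub>b\<^sub>C \<phi>}"
  have "\<exists>M\<in>S. \<forall>X\<in>S. M \<subseteq> X \<longrightarrow> X = M"
  proof (rule subset_Zorn_nonempty)
    show "S \<noteq> {}" using assms by (auto simp: S_def)
  next
    fix C assume C: "C \<noteq> {}" "subset.chain S C"
    then have "C \<subseteq> S" by (simp add: subset_chain_def)
    moreover have "\<not> \<Union>C \<turnstile>\<^sub>m\<^sub>b\<^sub>C \<phi>"
      using derivable_Union_chain[OF _ C(2,1)] \<open>C \<subseteq> S\<close> by (auto simp: S_def)
    ultimately show "\<Union>C \<in> S" using C(1) by (auto simp: S_def)
  qed
  then obtain \<Delta> where \<Delta>: "\<Delta> \<in> S" and max: "\<And>X. X \<in> S \<Longrightarrow> \<Delta> \<subseteq> X \<Longrightarrow> X = \<Delta>" by blast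
  have "insert a \<Delta> \<turnstile>\<^sub>m\<^sub>b\<^sub>C \<phi>" if "a \<notin> \<Delta>" for a
    using max[of "insert a \<Delta>"] \<Delta> that by (auto simp: S_def)
  then show ?thesis using that \<Delta> by (auto simp: S_def saturated_def)
qed

locale saturated_set =
  fixes \<phi> :: fm and \<Delta> :: "fm set"
  assumes saturated: "saturated \<phi> \<Delta>"
begin

lemma refutes: "a \<notin> \<Delta> \<Longrightarrow> \<Delta> \<turnstile>\<^sub>m\<^sub>b\<^sub>C Imp a \<phi>"
  using saturated by (simp add: saturated_def deduction_theorem)

lemma not_derivable: "\<not> \<Delta> \<turnstile>\<^sub>m\<^sub>b\<^sub>C \<phi>"
  using saturated by (simp add: saturated_def)

lemma derivable_iff_mem: "\<Delta> \<turnstile>\<^sub>m\<^sub>b\<^sub>C a \<longleftrightarrow> a \<in> \<Delta>"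
  using refutes not_derivable mbC_derivable.MP mbC_derivable.Premise by blast

lemma mem_MP: "a \<in> \<Delta> \<Longrightarrow> Imp a b \<in> \<Delta> \<Longrightarrow> b \<in> \<Delta>"
  unfolding derivable_iff_mem[symmetric] by (rule mbC_derivable.MP)

lemma mem_axiom: "mbC_axiom a \<Longrightarrow> a \<in> \<Delta>"
  unfolding derivable_iff_mem[symmetric] by (rule mbC_derivable.Axiom)

lemma mem_Conj: "Conj a b \<in> \<Delta> \<longleftrightarrow> a \<in> \<Delta> \<and> b \<in> \<Delta>"
  by (meson mem_MP mem_axiom Ax3 Ax4 Ax5)

text \<open>
  Maximality gives \<open>a \<rightarrow> \<phi>\<close> for each missing \<open>a\<close>, so a disjunction of two missing formulas would
  derive \<open>\<phi>\<close> by the axiom of case distinction.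
\<close>

lemma mem_Disj: "Disj a b \<in> \<Delta> \<longleftrightarrow> a \<in> \<Delta> \<or> b \<in> \<Delta>"
proof
  assume ab: "Disj a b \<in> \<Delta>"
  show "a \<in> \<Delta> \<or> b \<in> \<Delta>"
  proof (rule ccontr)
    assume "\<not> (a \<in> \<Delta> \<or> b \<in> \<Delta>)"
    then have "Imp a \<phi> \<in> \<Delta>" "Imp b \<phi> \<in> \<Delta>"
      using refutes derivable_iff_mem by blast+
    then have "\<phi> \<in> \<Delta>" using ab by (meson mem_MP mem_axiom Ax8)
    then show False using not_derivable derivable_iff_mem by blast
  qed
qed (meson mem_MP mem_axiom Ax6 Ax7)

lemma mem_Imp: "Imp a b \<in> \<Delta> \<longleftrightarrow> (a \<in> \<Delta> \<longrightarrow> b \<in> \<Delta>)"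
  by (meson mem_MP mem_axiom mem_Disj Ax1 Ax9)

lemma mem_Neg: "a \<notin> \<Delta> \<Longrightarrow> Neg a \<in> \<Delta>"
  using mem_Disj mem_axiom[OF Ax10] by blast

lemma mem_Circ: "Circ a \<in> \<Delta> \<Longrightarrow> a \<in> \<Delta> \<Longrightarrow> Neg a \<notin> \<Delta>"
  by (meson mem_MP mem_axiom bc1 not_derivable derivable_iff_mem)

end


section \<open>Algebras with one class of tops and one class of bottoms\<close>

text \<open>
  A predicate on record schemes, so that its consequences apply both to hyper Boolean algebras and to
  their expansions by \<open>nng\<close> and \<open>cns\<close>.
\<close>

definition two_class :: "'a set \<Rightarrow> ('a, 'm) hba_scheme \<Rightarrow> bool" where
  "two_class T B \<longleftrightarrow> T \<noteq> {} \<and> T \<noteq> UNIV \<and> carrier B = UNIV \<and>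
     le B = {(x, y). x \<in> T \<longrightarrow> y \<in> T} \<and> compl B = (\<lambda>x. {y. y \<in> T \<longleftrightarrow> x \<notin> T})"

text \<open>
  Every operation returns a full class, chosen by the Boolean operation on the classes of its
  arguments. Laws of the two-element Boolean algebra thus become equalities of sets.
\<close>

lemma two_class_ops:
  assumes "two_class T B"
  shows "infimoid B x y = {z. z \<in> T \<longleftrightarrow> x \<in> T \<and> y \<in> T}"
    and "supremoid B x y = {z. z \<in> T \<longleftrightarrow> x \<in> T \<or> y \<in> T}"
    and "himp B x y = {z. z \<in> T \<longleftrightarrow> (x \<in> T \<longrightarrow> y \<in> T)}"
    and "tops B = T" and "bots B = - T"
    and "equiv_sets B X Y \<longleftrightarrow> (\<forall>x\<in>X. \<forall>y\<in>Y. x \<in> T \<longleftrightarrow> y \<in> T)"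
proof -
  obtain t f where tf: "t \<in> T" "f \<notin> T"
    using assms by (auto simp: two_class_def)
  have le: "(x, y) \<in> le B \<longleftrightarrow> (x \<in> T \<longrightarrow> y \<in> T)" and carrier: "carrier B = UNIV"
    and compl: "compl B x = {y. y \<in> T \<longleftrightarrow> x \<notin> T}" for x y
    using assms by (simp_all add: two_class_def)
  show "infimoid B x y = {z. z \<in> T \<longleftrightarrow> x \<in> T \<and> y \<in> T}"
    using tf by (auto simp: infimoid_iff le carrier)
  show sup: "supremoid B x y = {z. z \<in> T \<longleftrightarrow> x \<in> T \<or> y \<in> T}" for x y
    using tf by (auto simp: supremoid_iff le carrier)
  show "himp B x y = {z. z \<in> T \<longleftrightarrow> (x \<in> T \<longrightarrow> y \<in> T)}"
    using tf by (auto simp: himp_def ext2_def sup compl)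
  show "tops B = T" "bots B = - T"
    using tf by (auto simp: tops_iff bots_iff le carrier)
  show "equiv_sets B X Y \<longleftrightarrow> (\<forall>x\<in>X. \<forall>y\<in>Y. x \<in> T \<longleftrightarrow> y \<in> T)"
    by (auto simp: equiv_sets_def le)
qed

text \<open>
  An argument may be any nonempty part of one class, so singletons and full classes are both covered
  and nested terms can be evaluated from the inside out.
\<close>

lemma two_class_ext2:
  assumes "two_class T B" and X: "X \<noteq> {}" "\<And>x. x \<in> X \<Longrightarrow> x \<in> T \<longleftrightarrow> p"
    and Y: "Y \<noteq> {}" "\<And>y. y \<in> Y \<Longrightarrow> y \<in> T \<longleftrightarrow> q"
  shows "X \<sqinter>[B] Y = {z. z \<in> T \<longleftrightarrow> p \<and> q}" and "X \<squnion>[B] Y = {z. z \<in> T \<longleftrightarrow> p \<or> q}"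
proof -
  have const: "ext2 f X Y = Z" if "\<And>x y. x \<in> X \<Longrightarrow> y \<in> Y \<Longrightarrow> f x y = Z"
    for f :: "'a \<Rightarrow> 'a \<Rightarrow> 'a set" and Z
    using that X(1) Y(1) by (auto simp: ext2_def)
  show "X \<sqinter>[B] Y = {z. z \<in> T \<longleftrightarrow> p \<and> q}"
    by (rule const) (simp add: two_class_ops[OF assms(1)] X(2) Y(2))
  show "X \<squnion>[B] Y = {z. z \<in> T \<longleftrightarrow> p \<or> q}"
    by (rule const) (simp add: two_class_ops[OF assms(1)] X(2) Y(2))
qed

lemma two_class_constraints:
  assumes B: "two_class T B"
  shows "{x} \<squnion>[B] {y} \<approx>[B] tops B \<longleftrightarrow> x \<in> T \<or> y \<in> T"
    and "({x} \<sqinter>[B] {y}) \<sqinter>[B] {z} \<approx>[B] bots B \<longleftrightarrow> \<not> (x \<in> T \<and> y \<in> T \<and> z \<in> T)"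
proof -
  obtain t f where tf: "t \<in> T" "f \<notin> T"
    using B by (auto simp: two_class_def)
  have inhabited: "\<exists>z. z \<in> T \<longleftrightarrow> P" for P
    using tf by blast
  have equiv: "{u. u \<in> T \<longleftrightarrow> P} \<approx>[B] tops B \<longleftrightarrow> P" "{u. u \<in> T \<longleftrightarrow> P} \<approx>[B] bots B \<longleftrightarrow> \<not> P" for P
    using tf by (cases P; auto simp: two_class_ops[OF B])+
  have "{x} \<squnion>[B] {y} = {u. u \<in> T \<longleftrightarrow> x \<in> T \<or> y \<in> T}"
    by (rule two_class_ext2[OF B]) simp_all
  then show "{x} \<squnion>[B] {y} \<approx>[B] tops B \<longleftrightarrow> x \<in> T \<or> y \<in> T"
    by (simp only: equiv)
  have "{x} \<sqinter>[B] {y} = {u. u \<in> T \<longleftrightarrow> x \<in> T \<and> y \<in> T}"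
    by (rule two_class_ext2[OF B]) simp_all
  moreover have "{u. u \<in> T \<longleftrightarrow> x \<in> T \<and> y \<in> T} \<sqinter>[B] {z} =
      {u. u \<in> T \<longleftrightarrow> (x \<in> T \<and> y \<in> T) \<and> z \<in> T}"
    by (rule two_class_ext2[OF B]) (use inhabited in simp_all)
  ultimately show "({x} \<sqinter>[B] {y}) \<sqinter>[B] {z} \<approx>[B] bots B \<longleftrightarrow> \<not> (x \<in> T \<and> y \<in> T \<and> z \<in> T)"
    by (simp only: equiv conj_assoc)
qed

lemma two_class_HBA:
  assumes B: "two_class T B"
  shows "is_HBA B"
proof -
  obtain t f where tf: "t \<in> T" "f \<notin> T"
    using B by (auto simp: two_class_def)
  have inhabited: "\<exists>z. z \<in> T \<longleftrightarrow> P" for P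
    using tf by blast
  have le: "le B = {(x, y). x \<in> T \<longrightarrow> y \<in> T}" and carrier: "carrier B = UNIV"
    and compl: "compl B = (\<lambda>x. {y. y \<in> T \<longleftrightarrow> x \<notin> T})"
    using B by (simp_all add: two_class_def)
  note ops = two_class_ops[OF B]
  have pre: "preorder_on (carrier B) (le B)"
    unfolding carrier le preorder_on_def by (auto simp: refl_on_def trans_def)
  have lat: "hyperlattice B"
    using pre inhabited by (simp add: hyperlattice_def carrier ops)
  have dist: "distributive_hyperlattice B"
    unfolding distributive_hyperlattice_def
  proof (intro conjI ballI lat)
    fix x y z :: 'a
    have join: "{u} \<squnion>[B] {v} = {z. z \<in> T \<longleftrightarrow> u \<in> T \<or> v \<in> T}"
      and meet: "{u} \<sqinter>[B] {v} = {z. z \<in> T \<longleftrightarrow> u \<in> T \<and> v \<in> T}" for u v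
      by (rule two_class_ext2[OF B]; simp)+
    have "{x} \<sqinter>[B] ({y} \<squnion>[B] {z}) = {u. u \<in> T \<longleftrightarrow> x \<in> T \<and> (y \<in> T \<or> z \<in> T)}"
      unfolding join by (rule two_class_ext2[OF B]) (use inhabited in simp_all)
    moreover have "({x} \<sqinter>[B] {y}) \<squnion>[B] ({x} \<sqinter>[B] {z}) =
        {u. u \<in> T \<longleftrightarrow> x \<in> T \<and> y \<in> T \<or> x \<in> T \<and> z \<in> T}"
      unfolding meet by (rule two_class_ext2[OF B]) (use inhabited in simp_all)
    ultimately show "{x} \<sqinter>[B] ({y} \<squnion>[B] {z}) = ({x} \<sqinter>[B] {y}) \<squnion>[B] ({x} \<sqinter>[B] {z})"
      by (simp only: conj_disj_distribL)
    have "{x} \<squnion>[B] ({y} \<sqinter>[B] {z}) = {u. u \<in> T \<longleftrightarrow> x \<in> T \<or> (y \<in> T \<and> z \<in> T)}"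
      unfolding meet by (rule two_class_ext2[OF B]) (use inhabited in simp_all)
    moreover have "({x} \<squnion>[B] {y}) \<sqinter>[B] ({x} \<squnion>[B] {z}) =
        {u. u \<in> T \<longleftrightarrow> (x \<in> T \<or> y \<in> T) \<and> (x \<in> T \<or> z \<in> T)}"
      unfolding join by (rule two_class_ext2[OF B]) (use inhabited in simp_all)
    ultimately show "{x} \<squnion>[B] ({y} \<sqinter>[B] {z}) = ({x} \<squnion>[B] {y}) \<sqinter>[B] ({x} \<squnion>[B] {z})"
      by (simp only: disj_conj_distribL)
  qed
  have "{x} \<squnion>[B] compl B x = T" "{x} \<sqinter>[B] compl B x = - T" for x
  proof -
    have c: "y \<in> T \<longleftrightarrow> x \<notin> T" if "y \<in> compl B x" for y
      using that by (auto simp: compl)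
    have ne: "compl B x \<noteq> {}" using inhabited by (simp add: compl)
    have "{x} \<squnion>[B] compl B x = {z. z \<in> T \<longleftrightarrow> x \<in> T \<or> x \<notin> T}"
      by (rule two_class_ext2[OF B]) (use ne c in simp_all)
    then show "{x} \<squnion>[B] compl B x = T" by simp
    have "{x} \<sqinter>[B] compl B x = {z. z \<in> T \<longleftrightarrow> x \<in> T \<and> x \<notin> T}"
      by (rule two_class_ext2[OF B]) (use ne c in simp_all)
    then show "{x} \<sqinter>[B] compl B x = - T" by auto
  qed
  moreover have "bounded_hyperlattice B"
    using lat tf by (auto simp: bounded_hyperlattice_def ops)
  moreover have "hyperop1 (carrier B) (compl B)"
    using inhabited by (simp add: hyperop1_def carrier compl)
  moreover have "x \<in> ext1 (compl B) (compl B x)" for x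
    using inhabited[of "x \<notin> T"] by (simp add: ext1_def compl)
  ultimately show ?thesis
    unfolding is_HBA_def using dist by (auto simp: ops carrier compl)
qed

text \<open>
  For \<open>b\<close> in \<open>T\<close>, the element \<open>b\<close> stands for a true formula whose negation may be true, and all other
  members of \<open>T\<close> for true formulas whose negation is false. Among true formulas, exactly the latter
  may be consistent; a false formula is subject only to the requirement that its negation is true.
\<close>

definition glutty_HmbCA :: "'a set \<Rightarrow> 'a \<Rightarrow> 'a hmbca" where
  "glutty_HmbCA T b =
     \<lparr> carrier = UNIV, le = {(x, y). x \<in> T \<longrightarrow> y \<in> T}, compl = (\<lambda>x. {y. y \<in> T \<longleftrightarrow> x \<notin> T}),
       nng = (\<lambda>x. if x = b then UNIV else {y. y \<in> T \<longleftrightarrow> x \<notin> T}),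
       cns = (\<lambda>x. if x = b then - T else UNIV) \<rparr>"

lemma two_class_glutty_HmbCA:
  "T \<noteq> {} \<Longrightarrow> T \<noteq> UNIV \<Longrightarrow> two_class T (glutty_HmbCA T b)"
  by (simp add: two_class_def glutty_HmbCA_def)

lemma glutty_HmbCA_is_HmbCA:
  assumes "b \<in> T" "T \<noteq> UNIV"
  shows "is_HmbCA (glutty_HmbCA T b)"
proof -
  let ?A = "glutty_HmbCA T b"
  have A: "two_class T ?A"
    using assms by (intro two_class_glutty_HmbCA) auto
  have fields: "nng ?A = (\<lambda>x. if x = b then UNIV else {y. y \<in> T \<longleftrightarrow> x \<notin> T})"
    "cns ?A = (\<lambda>x. if x = b then - T else UNIV)" "carrier ?A = UNIV"
    by (simp_all add: glutty_HmbCA_def)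
  have "{y. y \<in> T \<longleftrightarrow> x \<notin> T} \<noteq> {}" for x
    using assms by blast
  then have "hyperop1 (carrier ?A) (nng ?A)" "hyperop1 (carrier ?A) (cns ?A)"
    using assms by (auto simp: hyperop1_def fields)
  moreover have "x \<in> T \<or> y \<in> T" if "y \<in> nng ?A x" for x y
    using that assms by (auto simp: fields split: if_splits)
  moreover have "\<not> (x \<in> T \<and> y \<in> T \<and> z \<in> T)" if "y \<in> nng ?A x" "z \<in> cns ?A x" for x y z
    using that by (auto simp: fields split: if_splits)
  ultimately show ?thesis
    unfolding is_HmbCA_def two_class_constraints[OF A] using two_class_HBA[OF A] by blast
qed


section \<open>Completeness\<close>

context saturated_set
begin

lemma two_class_hba_valuation:
  assumes B: "two_class T B" and w: "\<And>a. w a \<in> T \<longleftrightarrow> a \<in> \<Delta>"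
  shows "hba_valuation B w"
proof -
  have "carrier B = UNIV" using B by (simp add: two_class_def)
  then show ?thesis
    unfolding hba_valuation_def
    unfolding two_class_constraints[OF B] unfolding two_class_ops[OF B]
    using mem_Neg mem_Circ by (simp add: w mem_Conj mem_Disj mem_Imp) blast
qed

lemma glutty_HmbCA_valuation:
  assumes T: "b \<in> T" "T \<noteq> UNIV" and w: "\<And>a. w a \<in> T \<longleftrightarrow> a \<in> \<Delta>"
    and glut: "\<And>a. w a = b \<longleftrightarrow> a \<in> \<Delta> \<and> Neg a \<in> \<Delta>"
  shows "valuation (HmbCA_sigma (glutty_HmbCA T b)) w"
proof -
  let ?A = "glutty_HmbCA T b"
  have A: "two_class T ?A"
    using T by (intro two_class_glutty_HmbCA) auto
  have fields: "nng ?A = (\<lambda>x. if x = b then UNIV else {y. y \<in> T \<longleftrightarrow> x \<notin> T})"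
    "cns ?A = (\<lambda>x. if x = b then - T else UNIV)" "carrier ?A = UNIV"
    by (simp_all add: glutty_HmbCA_def)
  show ?thesis
    unfolding valuation_def HmbCA_sigma_def
    using mem_Neg mem_Circ
    by (auto simp: two_class_ops[OF A] fields w glut mem_Conj mem_Disj mem_Imp)
qed

end

lemma HSW_completeness:
  assumes inf: "infinite (UNIV :: 'a set)" and cons: "HSW_consequence TYPE('a) \<Gamma> \<phi>"
  shows "\<Gamma> \<turnstile>\<^sub>m\<^sub>b\<^sub>C \<phi>"
proof (rule ccontr)
  assume "\<not> \<Gamma> \<turnstile>\<^sub>m\<^sub>b\<^sub>C \<phi>"
  then obtain \<Delta> where \<Gamma>: "\<Gamma> \<subseteq> \<Delta>" and \<Delta>: "saturated \<phi> \<Delta>"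
    by (rule saturated_extension_exists)
  interpret saturated_set \<phi> \<Delta> by unfold_locales (rule \<Delta>)
  obtain t f :: 'a where tf: "f \<noteq> t"
    using ex_new_if_finite[OF inf, of "{undefined}"] by auto
  define B :: "'a hba" where
    "B = \<lparr> carrier = UNIV, le = {(x, y). x = t \<longrightarrow> y = t}, compl = (\<lambda>x. {y. y = t \<longleftrightarrow> x \<noteq> t}) \<rparr>"
  define w where "w a = (if a \<in> \<Delta> then t else f)" for a
  have B: "two_class {t} B"
    using tf by (auto simp: two_class_def B_def)
  have w: "w a \<in> {t} \<longleftrightarrow> a \<in> \<Delta>" for a
    using tf by (simp add: w_def)
  let ?v = "\<lambda>a. (w a, w (Neg a), w (Circ a))"
  have v: "valuation (swap_sigma B) ?v"
    by (intro hba_valuation_imp_swap_valuation two_class_hba_valuation[OF B] w)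
  then have "?v a \<in> swap_dom B" for a
    by (simp add: valuation_def swap_sigma_def)
  then have des: "?v a \<in> swap_designated B \<longleftrightarrow> a \<in> \<Delta>" for a
    using w by (simp add: swap_designated_def two_class_ops[OF B])
  have "entails (swap_sigma B) (swap_designated B) \<Gamma> \<phi>"
    using cons two_class_HBA[OF B] by (simp add: HSW_consequence_def)
  then have "?v \<phi> \<in> swap_designated B"
    using v \<Gamma> des unfolding entails_def by blast
  then show False
    using des not_derivable derivable_iff_mem by blast
qed

lemma HmbCA_completeness:
  assumes inf: "infinite (UNIV :: 'a set)" and cons: "HmbCA_consequence TYPE('a) \<Gamma> \<phi>"
  shows "\<Gamma> \<turnstile>\<^sub>m\<^sub>b\<^sub>C \<phi>"
proof (rule ccontr)
  assume "\<not> \<Gamma> \<turnstile>\<^sub>m\<^sub>b\<^sub>C \<phi>"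
  then obtain \<Delta> where \<Gamma>: "\<Gamma> \<subseteq> \<Delta>" and \<Delta>: "saturated \<phi> \<Delta>"
    by (rule saturated_extension_exists)
  interpret saturated_set \<phi> \<Delta> by unfold_locales (rule \<Delta>)
  obtain X :: "'a set" where "card X = 3"
    using infinite_arbitrarily_large[OF inf, of 3] by blast
  then obtain a b f :: 'a where abf: "b \<noteq> a" "f \<noteq> a" "f \<noteq> b"
    unfolding card_3_iff by blast
  define w where "w c = (if c \<notin> \<Delta> then f else if Neg c \<in> \<Delta> then b else a)" for c
  let ?A = "glutty_HmbCA {a, b} b"
  have "f \<notin> {a, b}" using abf by simp
  then have T: "b \<in> {a, b}" "{a, b} \<noteq> UNIV" by blast+
  have w: "w c \<in> {a, b} \<longleftrightarrow> c \<in> \<Delta>" and glut: "w c = b \<longleftrightarrow> c \<in> \<Delta> \<and> Neg c \<in> \<Delta>" for c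
    using abf by (auto simp: w_def)
  have v: "valuation (HmbCA_sigma ?A) w"
    by (rule glutty_HmbCA_valuation[OF T w glut])
  have tops: "tops ?A = {a, b}"
    using T(2) by (intro two_class_ops(4)[OF two_class_glutty_HmbCA]) simp_all
  have "entails (HmbCA_sigma ?A) (tops ?A) \<Gamma> \<phi>"
    using cons glutty_HmbCA_is_HmbCA[OF T] by (simp add: HmbCA_consequence_def)
  moreover have "\<forall>\<gamma>\<in>\<Gamma>. w \<gamma> \<in> tops ?A"
    using \<Gamma> w unfolding tops by blast
  ultimately have "w \<phi> \<in> {a, b}"
    using v unfolding entails_def tops by blast
  then have "\<phi> \<in> \<Delta>" by (simp only: w)
  then show False
    using not_derivable derivable_iff_mem by blast
qed

theorem theorem5p8:
  fixes \<Gamma> :: "fm set" and \<phi> :: fm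
  shows
    "(\<Gamma> \<turnstile>\<^sub>m\<^sub>b\<^sub>C \<phi> \<longrightarrow> HmbCA_consequence TYPE('a) \<Gamma> \<phi>) \<and>
     (\<Gamma> \<turnstile>\<^sub>m\<^sub>b\<^sub>C \<phi> \<longrightarrow> HSW_consequence TYPE('b) \<Gamma> \<phi>) \<and>
     (infinite (UNIV :: 'a set) \<longrightarrow>
        (\<Gamma> \<turnstile>\<^sub>m\<^sub>b\<^sub>C \<phi> \<longleftrightarrow> HmbCA_consequence TYPE('a) \<Gamma> \<phi>)) \<and>
     (infinite (UNIV :: 'b set) \<longrightarrow>
        (\<Gamma> \<turnstile>\<^sub>m\<^sub>b\<^sub>C \<phi> \<longleftrightarrow> HSW_consequence TYPE('b) \<Gamma> \<phi>))"
  using HmbCA_soundness HSW_soundness HmbCA_completeness HSW_completeness by blast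

end
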